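(* Let $A\colon\mathbb R^N\to\mathbb R^M$ and $D\colon\mathbb R^S\to\mathbb R^N$ be linear operators, $y\in\mathbb R^M$, $\lambda>0$, and let $g\colon\mathbb R^S\to\mathbb R$ be convex, lower semi-continuous and proper. Let $\tau,\zeta>0$, $x_0\in\mathbb R^N$, $z_0\in\mathbb R^S$, and let $(z_k)_{k\in\mathbb N}$ and $(x_k)_{k\in\mathbb N}$ be generated by the following FB-PnP algorithm with one synthesis-denoiser sub-iteration per iteration and warm restart: for $k=0,1,\ldots$ $$ \begin{aligned} v_k&=x_k-\tau A^*(Ax_k-y),\\ z_{k+1}&=\operatorname{prox}_{\zeta g_{\tau\lambda}}\big(z_k-\zeta D^*(Dz_k-v_k)\big),\\ x_{k+1}&=Dz_{k+1}. \end{aligned} $$ Assume that $0<\tau\zeta<2\|AD\|_S^{-2}$. Then (i) $(z_k)_{k\in\mathbb N}$ converges to a solution to the problem: find $\widehat z\in\operatorname{Argmin}_{z\in\mathbb R^S}\frac12\|ADz-y\|^2+g_\lambda(z)$; (ii) $(x_k)_{k\in\mathbb N}$ converges to a solution to the problem: find $\widehat x\in\operatorname{Argmin}_{x\in\mathbb R^N}\frac12\|Ax-y\|^2+(D\rhd g_\lambda)(x)$.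
   Context: For $c>0$, $g_c:=c\,g$ (so $g_\lambda=\lambda g$ and $g_{\tau\lambda}=\tau\lambda g$). $\|\cdot\|$ is the Euclidean norm, $\|\cdot\|_S$ the spectral norm, and $^*$ on operators denotes the adjoint. For a proper lower semi-continuous convex function $h$, $\operatorname{prox}_h(v)=\operatorname{argmin}_x h(x)+\frac12\|x-v\|^2$. The infimal post-composition of $g_\lambda$ by $D$ is $D\rhd g_\lambda\colon\mathbb R^N\to[-\infty,+\infty]\colon x\mapsto\inf_{z\in\mathbb R^S,\ x=Dz}g_\lambda(z)$, equal to $+\infty$ when $\{z\in\mathbb R^S\mid x=Dz\}$ is empty. $\operatorname{Argmin}$ denotes the set of minimizers. The minimization problem over $z$ is posed as finding an element of $\operatorname{Argmin}$, so it is understood to have at least one solution. *)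

theory Defs
  imports "HOL-Analysis.Analysis"
begin

definition Argmin :: "('a \<Rightarrow> 'b::linorder) \<Rightarrow> 'a set" where
  "Argmin f = {x. is_arg_min f (\<lambda>_. True) x}"

definition proper :: "('a \<Rightarrow> ereal) \<Rightarrow> bool" where
  "proper f \<longleftrightarrow> (\<forall>x. f x \<noteq> -\<infinity>) \<and> (\<exists>x. f x \<noteq> \<infinity>)"

definition lower_semicontinuous :: "('a::topological_space \<Rightarrow> ereal) \<Rightarrow> bool" where
  "lower_semicontinuous f \<longleftrightarrow> (\<forall>x. f x \<le> Liminf (at x) f)"

(* arg_min selects one of the minimizers; for convex, lower semicontinuous h on a
   Euclidean space there is exactly one. *)
definition prox :: "('a::real_inner \<Rightarrow> real) \<Rightarrow> 'a \<Rightarrow> 'a" where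
  "prox h v = arg_min (\<lambda>x. h x + 1/2 * (norm (x - v))\<^sup>2) (\<lambda>_. True)"

(* The infimum is taken in ereal, so it is \<infinity> when x is not in the range of D. *)
definition infimal_postcomp :: "('a \<Rightarrow> 'b) \<Rightarrow> ('a \<Rightarrow> ereal) \<Rightarrow> 'b \<Rightarrow> ereal"
    (infixr \<open>\<rhd>\<close> 70) where
  "(D \<rhd> h) x = (INF z\<in>{z. x = D z}. h z)"

end

theory Submission
  imports Defs
begin

text \<open>Since \<open>x\<^sub>k = D z\<^sub>k\<close> for \<open>k \<ge> 1\<close>, the algorithm is, from its second step on,
  forward-backward splitting with step size \<open>\<gamma> = \<tau>\<zeta>\<close> for the synthesis problem. For a convex function
  \<open>h\<close> plus a least-squares term \<open>1/2 \<parallel>T u - b\<parallel>\<^sup>2\<close>, minimality is equivalent to a variational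
  inequality. Adding the inequality of a proximal step to that of a solution \<open>s\<close>, with
  \<open>B = A \<circ> D\<close>, gives
  \<open>\<parallel>z\<^sub>k\<^sub>+\<^sub>1 - s\<parallel>\<^sup>2 \<le> \<parallel>z\<^sub>k - s\<parallel>\<^sup>2 - (1 - \<gamma>\<parallel>B\<parallel>\<^sup>2/2) \<parallel>z\<^sub>k\<^sub>+\<^sub>1 - z\<^sub>k\<parallel>\<^sup>2\<close>.
  Hence the steps vanish, every cluster point is a solution, and Fejer monotonicity upgrades
  subsequential convergence to convergence.\<close>

lemma Argmin_iff: "p \<in> Argmin f \<longleftrightarrow> (\<forall>u. f p \<le> f u)"
  by (auto simp: Argmin_def is_arg_min_def not_less)

text \<open>Forward: compare \<open>p\<close> with \<open>p + t *\<^sub>R (u - p)\<close>, bound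
  \<open>h\<close> there by convexity, divide by \<open>t\<close> and let \<open>t\<close> tend to 0
  from the right. Backward: the exact expansion at \<open>t = 1\<close> leaves a nonnegative square.
  With \<open>T\<close> the identity this describes a proximal point, with \<open>T = B\<close> a
  solution of the synthesis problem.\<close>

lemma Argmin_least_squares_iff:
  fixes T :: "'a::real_vector \<Rightarrow> 'b::real_inner"
  assumes T: "linear T" and h: "convex_on UNIV h"
  shows "p \<in> Argmin (\<lambda>u. 1/2 * (norm (T u - b))\<^sup>2 + h u) \<longleftrightarrow>
         (\<forall>u. h p \<le> h u + inner (T p - b) (T (u - p)))"
proof -
  have expand: "(norm (T (p + t *\<^sub>R d) - b))\<^sup>2 =
      (norm (T p - b))\<^sup>2 + 2 * t * inner (T p - b) (T d) + t\<^sup>2 * (norm (T d))\<^sup>2" for t d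
    unfolding power2_norm_eq_inner linear_add[OF T] linear_scale[OF T]
    by (simp add: algebra_simps inner_commute power2_eq_square)
  show ?thesis
  proof
    assume "p \<in> Argmin (\<lambda>u. 1/2 * (norm (T u - b))\<^sup>2 + h u)"
    then have min: "1/2 * (norm (T p - b))\<^sup>2 + h p \<le> 1/2 * (norm (T u - b))\<^sup>2 + h u" for u
      by (simp add: Argmin_iff)
    show "\<forall>u. h p \<le> h u + inner (T p - b) (T (u - p))"
    proof
      fix u
      let ?i = "inner (T p - b) (T (u - p))" and ?n = "(norm (T (u - p)))\<^sup>2"
      have ev: "\<forall>\<^sub>F t in at_right 0. h p \<le> h u + ?i + t / 2 * ?n"
        unfolding eventually_at_right_field
      proof (intro exI conjI allI impI)
        show "(0::real) < 1" by simp
        fix t :: real assume t: "0 < t" "t < 1"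
        have "p + t *\<^sub>R (u - p) = (1 - t) *\<^sub>R p + t *\<^sub>R u" by (simp add: algebra_simps)
        with convex_onD[OF h, of t p u] t
        have "h (p + t *\<^sub>R (u - p)) \<le> (1 - t) * h p + t * h u" by simp
        with min[of "p + t *\<^sub>R (u - p)"]
        have "t * h p \<le> t * (h u + ?i + t / 2 * ?n)"
          unfolding expand by (simp add: algebra_simps power2_eq_square)
        with t show "h p \<le> h u + ?i + t / 2 * ?n" by simp
      qed
      have "((\<lambda>t. h u + ?i + t / 2 * ?n) \<longlongrightarrow> h u + ?i + 0 / 2 * ?n) (at_right 0)"
        by (intro tendsto_intros) simp
      from tendsto_lowerbound[OF this ev] show "h p \<le> h u + ?i" by simp
    qed
  next
    assume var: "\<forall>u. h p \<le> h u + inner (T p - b) (T (u - p))"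
    show "p \<in> Argmin (\<lambda>u. 1/2 * (norm (T u - b))\<^sup>2 + h u)"
      unfolding Argmin_iff
    proof
      fix u
      show "1/2 * (norm (T p - b))\<^sup>2 + h p \<le> 1/2 * (norm (T u - b))\<^sup>2 + h u"
        using var[rule_format, of u] expand[of 1 "u - p", simplified]
          zero_le_power2[of "norm (T (u - p))"]
        by linarith
    qed
  qed
qed

text \<open>An affine minorant of \<open>h\<close> is eventually dominated by the quadratic term, so
  a minimizer over a large ball is a global one. Existence then carries over to the point that
  \<open>arg_min\<close> selects.\<close>

lemma prox_in_Argmin:
  fixes h :: "'a::euclidean_space \<Rightarrow> real"
  assumes h: "continuous_on UNIV h" and minorant: "\<And>u. c + inner s u \<le> h u"
  shows "prox h v \<in> Argmin (\<lambda>u. h u + 1/2 * (norm (u - v))\<^sup>2)"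
proof -
  define \<phi> where "\<phi> u = h u + 1/2 * (norm (u - v))\<^sup>2" for u
  define e where "e = \<bar>h v - c - inner s v\<bar>"
  \<comment> \<open>Chosen so that at distance \<open>r > R\<close> from \<open>v\<close> both
    \<open>r \<ge> 1\<close> and \<open>r / 2 - norm s \<ge> e\<close> hold; their product shows
    that the objective there is at least its value at the centre \<open>v\<close>.\<close>
  define R where "R = 2 * norm s + 2 * e + 1"
  have R: "R \<ge> 1" unfolding R_def e_def by simp
  have "continuous_on (cball v R) \<phi>"
    unfolding \<phi>_def by (intro continuous_intros continuous_on_subset[OF h]) auto
  moreover have "cball v R \<noteq> {}" using R by simp
  ultimately obtain p where p: "\<And>u. u \<in> cball v R \<Longrightarrow> \<phi> p \<le> \<phi> u"
    using continuous_attains_inf[OF compact_cball] by metis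
  have "\<phi> p \<le> \<phi> u" for u
  proof (cases "u \<in> cball v R")
    case False
    let ?r = "norm (u - v)"
    have r: "R < ?r" using False by (simp add: dist_norm norm_minus_commute)
    have "- (norm s * ?r) \<le> inner s (u - v)"
      using Cauchy_Schwarz_ineq2[of s "u - v"] by linarith
    with minorant[of u] have "c + inner s v - norm s * ?r \<le> h u"
      by (simp add: inner_diff_right)
    moreover have "1 * e \<le> ?r * (?r / 2 - norm s)"
    proof (rule mult_mono)
      show "1 \<le> ?r" "0 \<le> ?r" using R r by simp_all
      show "e \<le> ?r / 2 - norm s" using r by (simp add: R_def)
      show "0 \<le> e" by (simp add: e_def)
    qed
    moreover have "h v \<le> c + inner s v + e" by (simp add: e_def)
    ultimately have "\<phi> v \<le> \<phi> u"
      by (simp add: \<phi>_def power2_eq_square algebra_simps)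
    moreover have "\<phi> p \<le> \<phi> v" using p[of v] R by simp
    ultimately show ?thesis by simp
  qed (use p in auto)
  then have "is_arg_min \<phi> (\<lambda>_. True) p" by (simp add: is_arg_min_linorder)
  then have "is_arg_min \<phi> (\<lambda>_. True) (arg_min \<phi> (\<lambda>_. True))"
    unfolding arg_min_def by (rule someI)
  then show ?thesis by (simp add: Argmin_def prox_def \<phi>_def[abs_def])
qed

lemma prox_variational_inequality:
  fixes h :: "'a::euclidean_space \<Rightarrow> real"
  assumes h: "convex_on UNIV h" and minorant: "\<And>u. c + inner s u \<le> h u"
  shows "h (prox h v) \<le> h u + inner (prox h v - v) (u - prox h v)"
proof -
  have "continuous_on UNIV h" by (rule convex_on_continuous[OF open_UNIV h])
  from prox_in_Argmin[OF this minorant]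
  have "prox h v \<in> Argmin (\<lambda>u. 1/2 * (norm (u - v))\<^sup>2 + h u)" by (simp add: add.commute)
  with Argmin_least_squares_iff[OF linear_id h, of "prox h v" v] show ?thesis by simp
qed

lemma Fejer_monotone_tendsto:
  fixes z :: "nat \<Rightarrow> 'a::metric_space"
  assumes fejer: "\<And>k. dist (z (Suc k)) s \<le> dist (z k) s"
    and r: "strict_mono r" "(z \<circ> r) \<longlonglongrightarrow> s"
  shows "z \<longlonglongrightarrow> s"
proof -
  have dec: "decseq (\<lambda>k. dist (z k) s)" by (rule decseq_SucI) (rule fejer)
  then obtain l where l: "(\<lambda>k. dist (z k) s) \<longlonglongrightarrow> l"
    using decseq_convergent[of _ 0] by (metis zero_le_dist)
  have "(\<lambda>k. dist (z (r k)) s) \<longlonglongrightarrow> 0"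
    using r(2) by (simp add: tendsto_dist_iff[of _ s] o_def)
  with LIMSEQ_subseq_LIMSEQ[OF l r(1)] have "l = 0"
    by (auto simp: o_def intro: LIMSEQ_unique)
  with l show ?thesis by (simp add: tendsto_dist_iff[of z s])
qed

theorem forward_backward_convergence:
  fixes B :: "'a::euclidean_space \<Rightarrow> 'b::euclidean_space"
  assumes B: "linear B" and h: "convex_on UNIV h"
    and \<gamma>: "\<gamma> > 0" "\<gamma> * (onorm B)\<^sup>2 < 2"
    and step: "\<And>k. z (Suc k) = prox (\<lambda>u. \<gamma> * h u) (z k - \<gamma> *\<^sub>R adjoint B (B (z k) - y))"
    and sol: "Argmin (\<lambda>u. 1/2 * (norm (B u - y))\<^sup>2 + h u) \<noteq> {}"
  shows "\<exists>s \<in> Argmin (\<lambda>u. 1/2 * (norm (B u - y))\<^sup>2 + h u). z \<longlonglongrightarrow> s"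
proof -
  let ?S = "Argmin (\<lambda>u. 1/2 * (norm (B u - y))\<^sup>2 + h u)"
  note S_iff = Argmin_least_squares_iff[OF B h]
  obtain s\<^sub>0 where s\<^sub>0: "s\<^sub>0 \<in> ?S" using sol by blast
  have bl: "bounded_linear B" using B by (simp add: linear_conv_bounded_linear)
  have convex: "convex_on UNIV (\<lambda>u. \<gamma> * h u)"
    using h \<gamma> by (intro convex_on_cmul) auto
  define a where "a = adjoint B (B s\<^sub>0 - y)"
  \<comment> \<open>The variational inequality at a solution says that \<open>- a\<close> is a
    subgradient of \<open>h\<close> at \<open>s\<^sub>0\<close>. Solvability of the problem thus
    supplies the affine minorant that makes every proximal step well defined.\<close>
  have minorant: "\<gamma> * (h s\<^sub>0 + inner a s\<^sub>0) + inner (- \<gamma> *\<^sub>R a) u \<le> \<gamma> * h u" for u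
  proof -
    have "h s\<^sub>0 \<le> h u + inner (B s\<^sub>0 - y) (B (u - s\<^sub>0))" using s\<^sub>0 S_iff by blast
    also have "inner (B s\<^sub>0 - y) (B (u - s\<^sub>0)) = inner a (u - s\<^sub>0)"
      by (simp add: a_def adjoint_clauses[OF B])
    finally have "\<gamma> * h s\<^sub>0 \<le> \<gamma> * (h u + inner a (u - s\<^sub>0))" using \<gamma> by simp
    then show ?thesis by (simp add: algebra_simps)
  qed
  have prox: "\<gamma> * h (z (Suc k)) \<le> \<gamma> * h u + inner (z (Suc k) - z k) (u - z (Suc k))
      + \<gamma> * inner (B (z k) - y) (B (u - z (Suc k)))" for k u
    using prox_variational_inequality[OF convex minorant,
        of "z k - \<gamma> *\<^sub>R adjoint B (B (z k) - y)" u, folded step]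
    by (simp add: algebra_simps adjoint_clauses[OF B] linear_diff[OF B])

  define \<epsilon> where "\<epsilon> = 1 - \<gamma> * (onorm B)\<^sup>2 / 2"
  have \<epsilon>: "\<epsilon> > 0" using \<gamma> by (simp add: \<epsilon>_def)
  have descent: "(dist (z (Suc k)) s)\<^sup>2 + \<epsilon> * (dist (z (Suc k)) (z k))\<^sup>2 \<le> (dist (z k) s)\<^sup>2"
    if s: "s \<in> ?S" for s k
  proof -
    let ?p = "z (Suc k)" and ?q = "z k"
    have "h s \<le> h ?p + inner (B s - y) (B (?p - s))" using s S_iff by blast
    then have "\<gamma> * h s \<le> \<gamma> * (h ?p + inner (B s - y) (B (?p - s)))" using \<gamma> by simp
    with prox[of k s]
    have 1: "0 \<le> inner (?p - ?q) (s - ?p) + \<gamma> * - inner (B (?q - s)) (B (?p - s))"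
      by (simp add: algebra_simps linear_diff[OF B])
    \<comment> \<open>Completing the square: \<open>B (?p - s)\<close> is \<open>B (?q - s)\<close>
      minus \<open>B (?q - ?p)\<close>. The resulting factor 1/4 is what allows step sizes up to 2
      over the squared norm of \<open>B\<close>.\<close>
    have "0 \<le> (norm (B (?q - s) - (1/2) *\<^sub>R B (?q - ?p)))\<^sup>2" by simp
    also have "\<dots> = inner (B (?q - s)) (B (?p - s)) + (norm (B (?q - ?p)))\<^sup>2 / 4"
      unfolding power2_norm_eq_inner linear_diff[OF B]
      by (simp add: algebra_simps inner_commute add_divide_distrib diff_divide_distrib)
    finally have "- inner (B (?q - s)) (B (?p - s)) \<le> (norm (B (?q - ?p)))\<^sup>2 / 4" by simp
    also have "\<dots> \<le> (onorm B * norm (?q - ?p))\<^sup>2 / 4"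
      using onorm[OF bl, of "?q - ?p"] by (intro divide_right_mono power_mono) auto
    finally have "\<gamma> * - inner (B (?q - s)) (B (?p - s)) \<le> \<gamma> * ((onorm B * norm (?q - ?p))\<^sup>2 / 4)"
      using \<gamma> by (intro mult_left_mono) auto
    also have "\<dots> = (1 - \<epsilon>) / 2 * (dist ?p ?q)\<^sup>2"
      by (simp add: \<epsilon>_def dist_norm norm_minus_commute power_mult_distrib)
    finally have 2: "0 \<le> inner (?p - ?q) (s - ?p) + (1 - \<epsilon>) / 2 * (dist ?p ?q)\<^sup>2" using 1 by linarith
    have "(dist ?q s)\<^sup>2 = (dist ?p s)\<^sup>2 + (dist ?p ?q)\<^sup>2 + 2 * inner (?p - ?q) (s - ?p)"
      unfolding dist_norm power2_norm_eq_inner by (simp add: algebra_simps inner_commute)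
    with 2 show ?thesis by (simp add: algebra_simps diff_divide_distrib)
  qed
  have fejer: "dist (z (Suc k)) s \<le> dist (z k) s" if "s \<in> ?S" for s k
  proof (rule power2_le_imp_le)
    have "0 \<le> \<epsilon> * (dist (z (Suc k)) (z k))\<^sup>2" using \<epsilon> by simp
    with descent[OF that, of k] show "(dist (z (Suc k)) s)\<^sup>2 \<le> (dist (z k) s)\<^sup>2" by linarith
  qed simp

  let ?d = "\<lambda>k. (dist (z k) s\<^sub>0)\<^sup>2"
  have "decseq ?d"
    by (rule decseq_SucI) (use fejer[OF s\<^sub>0] in \<open>auto intro: power_mono\<close>)
  then obtain l where l: "?d \<longlonglongrightarrow> l" using decseq_convergent[of ?d 0] by auto
  \<comment> \<open>By \<open>descent\<close>, each squared step is at most a multiple of the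
    difference of consecutive terms of the convergent sequence \<open>?d\<close>.\<close>
  have "(\<lambda>k. (dist (z (Suc k)) (z k))\<^sup>2) \<longlonglongrightarrow> 0"
  proof (rule tendsto_sandwich[OF _ _ tendsto_const])
    show "(\<lambda>k. (?d k - ?d (Suc k)) / \<epsilon>) \<longlonglongrightarrow> 0"
      using tendsto_divide[OF tendsto_diff[OF l LIMSEQ_Suc[OF l]] tendsto_const[of \<epsilon>]] \<epsilon> by simp
    show "\<forall>\<^sub>F k in sequentially. (dist (z (Suc k)) (z k))\<^sup>2 \<le> (?d k - ?d (Suc k)) / \<epsilon>"
      using descent[OF s\<^sub>0] \<epsilon> by (simp add: pos_le_divide_eq algebra_simps)
  qed simp
  from tendsto_real_sqrt[OF this] have "(\<lambda>k. dist (z (Suc k)) (z k)) \<longlonglongrightarrow> 0" by simp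
  then have steps: "(\<lambda>k. z (Suc k) - z k) \<longlonglongrightarrow> 0"
    by (simp add: dist_norm tendsto_norm_zero_iff)

  have "dist (z k) s\<^sub>0 \<le> dist (z 0) s\<^sub>0" for k
    by (induction k) (use fejer[OF s\<^sub>0] order_trans in blast)+
  then have "bounded (range z)"
    by (auto simp: bounded_any_center[where a = s\<^sub>0] dist_commute)
  then obtain s r where r: "strict_mono r" "(z \<circ> r) \<longlonglongrightarrow> s"
    using bounded_imp_convergent_subsequence by blast
  have zr: "(\<lambda>k. z (r k)) \<longlonglongrightarrow> s" using r by (simp add: o_def)
  have dr: "(\<lambda>k. z (Suc (r k)) - z (r k)) \<longlonglongrightarrow> 0"
    using LIMSEQ_subseq_LIMSEQ[OF steps r(1)] by (simp add: o_def)
  have zr': "(\<lambda>k. z (Suc (r k))) \<longlonglongrightarrow> s" using tendsto_add[OF dr zr] by simp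
  have "isCont h s"
    using convex_on_continuous[OF open_UNIV h] by (simp add: continuous_on_eq_continuous_at)
  then have hr: "(\<lambda>k. h (z (Suc (r k)))) \<longlonglongrightarrow> h s" by (rule isCont_tendsto_compose[OF _ zr'])
  have "s \<in> ?S"
    unfolding S_iff
  proof
    fix u
    \<comment> \<open>Pass to the limit in \<open>prox\<close> along the subsequence. Since the
      steps vanish, \<open>z (r k)\<close> and its successor share the limit \<open>s\<close>, and
      the term with \<open>inner 0\<close> drops out.\<close>
    have "(\<lambda>k. \<gamma> * h u + inner (z (Suc (r k)) - z (r k)) (u - z (Suc (r k)))
        + \<gamma> * inner (B (z (r k)) - y) (B (u - z (Suc (r k)))))
      \<longlonglongrightarrow> \<gamma> * h u + inner 0 (u - s) + \<gamma> * inner (B s - y) (B (u - s))"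
      by (intro tendsto_intros zr zr' dr bounded_linear.tendsto[OF bl])
    with tendsto_mult_left[OF hr]
    have "\<gamma> * h s \<le> \<gamma> * h u + inner 0 (u - s) + \<gamma> * inner (B s - y) (B (u - s))"
      by (rule LIMSEQ_le) (use prox in blast)
    then have "\<gamma> * h s \<le> \<gamma> * (h u + inner (B s - y) (B (u - s)))" by (simp add: distrib_left)
    with \<gamma> show "h s \<le> h u + inner (B s - y) (B (u - s))" by simp
  qed
  \<comment> \<open>\<open>fejer\<close> holds for every solution, hence also for the cluster point
    \<open>s\<close> just shown to be one.\<close>
  with Fejer_monotone_tendsto[OF fejer r] show ?thesis by blast
qed

text \<open>Minimizing over \<open>u\<close> can be done by first minimizing over each fibre of
  \<open>D\<close> and then over its base point \<open>w\<close>; \<open>p\<close> itself lies in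
  the fibre over \<open>D p\<close>.\<close>

lemma Argmin_infimal_postcomp:
  assumes "p \<in> Argmin (\<lambda>u. f (D u) + h u)"
  shows "D p \<in> Argmin (\<lambda>w. ereal (f w) + (D \<rhd> (\<lambda>u. ereal (h u))) w)"
  unfolding Argmin_iff
proof
  fix w
  have "ereal (f (D p)) + (D \<rhd> (\<lambda>u. ereal (h u))) (D p) \<le> ereal (f (D p)) + ereal (h p)"
    unfolding infimal_postcomp_def by (intro add_left_mono INF_lower) simp
  \<comment> \<open>Splitting off the finite number \<open>f w\<close> leaves a real lower bound for
    \<open>h\<close> on the fibre over \<open>w\<close>. An empty fibre has infimum \<infinity> and
    satisfies it trivially.\<close>
  also have "\<dots> = ereal (f w) + ereal (f (D p) + h p - f w)" by simp
  also have "\<dots> \<le> ereal (f w) + (D \<rhd> (\<lambda>u. ereal (h u))) w"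
    unfolding infimal_postcomp_def
  proof (intro add_left_mono INF_greatest)
    fix u assume "u \<in> {u. w = D u}"
    then show "ereal (f (D p) + h p - f w) \<le> ereal (h u)"
      using assms by (simp add: Argmin_iff algebra_simps)
  qed
  finally show "ereal (f (D p)) + (D \<rhd> (\<lambda>u. ereal (h u))) (D p)
      \<le> ereal (f w) + (D \<rhd> (\<lambda>u. ereal (h u))) w" .
qed

lemma adjoint_comp:
  fixes A :: "'b::euclidean_space \<Rightarrow> 'c::euclidean_space" and D :: "'a::euclidean_space \<Rightarrow> 'b"
  assumes "linear A" "linear D"
  shows "adjoint (A \<circ> D) = adjoint D \<circ> adjoint A"
  by (rule adjoint_unique) (simp add: adjoint_works assms)

theorem theorem3p8:
  fixes A :: "real ^ 'n \<Rightarrow> real ^ 'm"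
    and D :: "real ^ 's \<Rightarrow> real ^ 'n"
    and y :: "real ^ 'm"
    and g :: "real ^ 's \<Rightarrow> real"
    and lam \<tau> \<zeta> :: real
    and x\<^sub>0 :: "real ^ 'n" and z\<^sub>0 :: "real ^ 's"
    and x v :: "nat \<Rightarrow> real ^ 'n" and z :: "nat \<Rightarrow> real ^ 's"
  assumes "linear A" and "linear D"
    and "lam > 0"
    and "convex_on UNIV g"
    and "lower_semicontinuous (\<lambda>u. ereal (g u))"
    and "proper (\<lambda>u. ereal (g u))"
    and "\<tau> > 0" and "\<zeta> > 0"
    and "x 0 = x\<^sub>0" and "z 0 = z\<^sub>0"
    and "\<And>k. v k = x k - \<tau> *\<^sub>R adjoint A (A (x k) - y)"
    and "\<And>k. z (Suc k) = prox (\<lambda>u. \<zeta> * (\<tau> * lam * g u)) (z k - \<zeta> *\<^sub>R adjoint D (D (z k) - v k))"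
    and "\<And>k. x (Suc k) = D (z (Suc k))"
    and "0 < \<tau> * \<zeta>"
    and "ereal (\<tau> * \<zeta>) < 2 * inverse ((ereal (onorm (A \<circ> D)))\<^sup>2)"
    and "Argmin (\<lambda>u. 1/2 * (norm (A (D u) - y))\<^sup>2 + lam * g u) \<noteq> {}"
  shows "(\<exists>zhat \<in> Argmin (\<lambda>u. 1/2 * (norm (A (D u) - y))\<^sup>2 + lam * g u). z \<longlonglongrightarrow> zhat) \<and>
         (\<exists>xhat \<in> Argmin (\<lambda>w. ereal (1/2 * (norm (A w - y))\<^sup>2) + (D \<rhd> (\<lambda>u. ereal (lam * g u))) w).
            x \<longlonglongrightarrow> xhat)"
proof -
  let ?B = "A \<circ> D" and ?h = "\<lambda>u. lam * g u"
  let ?S = "Argmin (\<lambda>u. 1/2 * (norm (A (D u) - y))\<^sup>2 + lam * g u)"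
  have B: "linear ?B" using assms(1,2) by (rule linear_compose[rotated])
  have h: "convex_on UNIV ?h" using assms(3,4) by (intro convex_on_cmul) auto
  have \<gamma>: "\<tau> * \<zeta> * (onorm ?B)\<^sup>2 < 2"
  \<comment> \<open>For norm 0 the \<open>ereal\<close> inverse is \<infinity>, so the step-size
    hypothesis gives no bound, but the claim reduces to \<open>0 < 2\<close>.\<close>
  proof (cases "onorm ?B = 0")
    case False
    then have "ereal (\<tau> * \<zeta>) < ereal (2 * inverse ((onorm ?B)\<^sup>2))"
      using assms(15) by (simp add: power2_eq_square)
    with False show ?thesis by (simp add: field_simps)
  qed simp
  \<comment> \<open>The point \<open>x 0\<close> is unrelated to \<open>D (z 0)\<close>, so the first step is not a forward-backward step.\<close>
  have "z (Suc (Suc k)) = prox (\<lambda>u. \<tau> * \<zeta> * ?h u)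
      (z (Suc k) - (\<tau> * \<zeta>) *\<^sub>R adjoint ?B (?B (z (Suc k)) - y))" for k
  proof -
    have "adjoint D (D (z (Suc k)) - v (Suc k)) = \<tau> *\<^sub>R adjoint ?B (?B (z (Suc k)) - y)"
      by (simp add: assms(11,13) adjoint_comp[OF assms(1,2)]
          linear_scale[OF adjoint_linear[OF assms(2)]])
    with assms(12)[of "Suc k"] show ?thesis by (simp add: mult.commute mult.left_commute)
  qed
  from forward_backward_convergence[OF B h assms(14) \<gamma>, of "\<lambda>k. z (Suc k)", OF this]
  obtain s where s: "s \<in> ?S" and "(\<lambda>k. z (Suc k)) \<longlonglongrightarrow> s"
    using assms(16) by auto
  then have z: "z \<longlonglongrightarrow> s" by (simp add: filterlim_sequentially_Suc)
  have "bounded_linear D" using assms(2) by (simp add: linear_conv_bounded_linear)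
  from bounded_linear.tendsto[OF this LIMSEQ_Suc[OF z]]
  have "(\<lambda>k. x (Suc k)) \<longlonglongrightarrow> D s" unfolding assms(13) .
  then have "x \<longlonglongrightarrow> D s" by (rule LIMSEQ_imp_Suc)
  with s z Argmin_infimal_postcomp[of s "\<lambda>w. 1/2 * (norm (A w - y))\<^sup>2" D ?h] show ?thesis by blast
qed

end
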